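(* Let $(X,d,\ll,\leq,\tau)$ be an intrinsic, separable Lorentzian pre-length space and let $s>0$ be such that $\mathcal H^s_\tau$ is $\sigma$-finite. Then for every continuous function $\Omega\colon X\to(0,+\infty)$ and every Borel set $E\subseteq X$, $$\mathcal H^s_{\tau_\Omega}(E)=\int_E\Omega(x)^s\,d\mathcal H^s_\tau(x).$$
   Context: A Lorentzian pre-length space $(X,d,\ll,\leq,\tau)$ consists of a set $X$, a metric $d$ on $X$, two transitive relations $\ll,\leq$ on $X$ with $\leq$ reflexive and $\ll$ contained in $\leq$, and a map $\tau\colon X\times X\to[0,+\infty]$ which is lower semicontinuous with respect to the topology of $d$, satisfies $\tau(x,z)\geq\tau(x,y)+\tau(y,z)$ whenever $x\leq y\leq z$, satisfies $\tau(x,y)=0$ if $x\not\leq y$, and satisfies $\tau(x,y)>0$ if and only if $x\ll y$. Separable means that $(X,d)$ is separable. A curve is a continuous map from an interval into $X$. A non-constant curve $\gamma\colon I\to X$ is causal if $\gamma(t)\leq\gamma(s)$ for all $t<s$ in $I$. A causal curve from $x$ to $y$ is one defined on a compact interval, starting at $x$ and ending at $y$. For a causal curve $\gamma\colon[a,b]\to X$ put $$L_\Omega^\tau(\gamma):=\inf\Big\{\sum_{i=0}^{m-1}\max_{t\in[t_i,t_{i+1}]}\Omega(\gamma(t))\,\tau(\gamma(t_i),\gamma(t_{i+1}))\ :\ a=t_0<\dots<t_m=b\Big\},$$ let $L^\tau(\gamma)$ be the same quantity with $\Omega\equiv1$, and $$\tau_\Omega(x,y):=\sup\big(\{0\}\cup\{L_\Omega^\tau(\gamma):\gamma\text{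 a causal curve from }x\text{ to }y\}\big).$$ The space is intrinsic if $\tau(x,y)=\sup(\{0\}\cup\{L^\tau(\gamma):\gamma\text{ a causal curve from }x\text{ to }y\})$ for all $x,y$. Lorentzian Hausdorff measures. Let $J(p,q)=\{z:p\leq z\leq q\}$. For a Borel set $E\subseteq X$, $\delta>0$, $s>0$ and $\theta\in\{\tau,\tau_\Omega\}$ let $$\mathcal H^s_{\delta,\theta}(E):=\inf\Big\{\sum_{i\in\mathbb N}\omega_s\,\theta(p_i,q_i)^s\ :\ E\subseteq\bigcup_{i\in\mathbb N}J(p_i,q_i),\ \operatorname{diam}^d(J(p_i,q_i))<\delta\ \text{for all } i\Big\},$$ where $\omega_s:=\frac{\pi^{(s-1)/2}}{s\,\Gamma((s+1)/2)\,2^{s-1}}$, and $\mathcal H^s_\theta(E):=\lim_{\delta\to0^+}\mathcal H^s_{\delta,\theta}(E)$. These are measures on the Borel sets of $X$. The infimum over the empty set is $+\infty$, and only countable (possibly finite) covers are used. *)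

theory Defs
  imports "HOL-Analysis.Analysis"
begin

section \<open>Lorentzian pre-length spaces\<close>

text \<open>The metric space is the type \<open>'a\<close>; its metric is \<^const>\<open>dist\<close>.\<close>

locale lorentzian_pre_length_space =
  fixes ll :: "'a::metric_space \<Rightarrow> 'a \<Rightarrow> bool"  (infix \<open>\<lless>\<close> 50)
    and le :: "'a \<Rightarrow> 'a \<Rightarrow> bool"  (infix \<open>\<preceq>\<close> 50)
    and \<tau> :: "'a \<Rightarrow> 'a \<Rightarrow> ennreal"
  assumes ll_trans: "transp (\<lless>)"
    and le_trans: "transp (\<preceq>)"
    and le_refl: "reflp (\<preceq>)"
    and ll_imp_le: "x \<lless> y \<Longrightarrow> x \<preceq> y"
    and lower_semicontinuous: "open {p. c < \<tau> (fst p) (snd p)}"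
    and reverse_triangle: "x \<preceq> y \<Longrightarrow> y \<preceq> z \<Longrightarrow> \<tau> x y + \<tau> y z \<le> \<tau> x z"
    and tau_eq_0: "\<not> x \<preceq> y \<Longrightarrow> \<tau> x y = 0"
    and tau_pos_iff: "0 < \<tau> x y \<longleftrightarrow> x \<lless> y"


section \<open>Causal curves, lengths and conformal changes\<close>

text \<open>Being non-constant forces \<open>a < b\<close>.\<close>

definition causal_curve ::
    "('a::metric_space \<Rightarrow> 'a \<Rightarrow> bool) \<Rightarrow> real \<Rightarrow> real \<Rightarrow> (real \<Rightarrow> 'a) \<Rightarrow> bool" where
  "causal_curve le a b \<gamma> \<longleftrightarrow>
     continuous_on {a..b} \<gamma> \<and>
     \<not> \<gamma> constant_on {a..b} \<and>
     (\<forall>t\<in>{a..b}. \<forall>s\<in>{a..b}. t < s \<longrightarrow> le (\<gamma> t) (\<gamma> s))"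

definition causal_curve_from_to ::
    "('a::metric_space \<Rightarrow> 'a \<Rightarrow> bool) \<Rightarrow> 'a \<Rightarrow> 'a \<Rightarrow> real \<Rightarrow> real \<Rightarrow> (real \<Rightarrow> 'a) \<Rightarrow> bool" where
  "causal_curve_from_to le x y a b \<gamma> \<longleftrightarrow> causal_curve le a b \<gamma> \<and> \<gamma> a = x \<and> \<gamma> b = y"

definition is_partition :: "real \<Rightarrow> real \<Rightarrow> nat \<Rightarrow> (nat \<Rightarrow> real) \<Rightarrow> bool" where
  "is_partition a b m t \<longleftrightarrow> t 0 = a \<and> t m = b \<and> (\<forall>i<m. t i < t (Suc i))"

text \<open>
  For \<open>\<Omega>\<close> and \<open>\<gamma>\<close> continuous, the supremum below is the maximum over a compact interval.
\<close>

definition conf_length ::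
    "('a::metric_space \<Rightarrow> 'a \<Rightarrow> ennreal) \<Rightarrow> ('a \<Rightarrow> real) \<Rightarrow> real \<Rightarrow> real \<Rightarrow> (real \<Rightarrow> 'a) \<Rightarrow> ennreal" where
  "conf_length \<tau> \<Omega> a b \<gamma> =
     Inf {\<Sum>i<m. ennreal (SUP u\<in>{t i..t (Suc i)}. \<Omega> (\<gamma> u)) * \<tau> (\<gamma> (t i)) (\<gamma> (t (Suc i))) | m t.
            is_partition a b m t}"

definition conf_tau ::
    "('a::metric_space \<Rightarrow> 'a \<Rightarrow> bool) \<Rightarrow> ('a \<Rightarrow> 'a \<Rightarrow> ennreal) \<Rightarrow> ('a \<Rightarrow> real) \<Rightarrow> 'a \<Rightarrow> 'a \<Rightarrow> ennreal" where
  "conf_tau le \<tau> \<Omega> x y =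
     Sup ({0} \<union> {conf_length \<tau> \<Omega> a b \<gamma> | a b \<gamma>. causal_curve_from_to le x y a b \<gamma>})"

definition tau_length ::
    "('a::metric_space \<Rightarrow> 'a \<Rightarrow> ennreal) \<Rightarrow> real \<Rightarrow> real \<Rightarrow> (real \<Rightarrow> 'a) \<Rightarrow> ennreal" where
  "tau_length \<tau> a b \<gamma> = conf_length \<tau> (\<lambda>_. 1) a b \<gamma>"

definition intrinsic ::
    "('a::metric_space \<Rightarrow> 'a \<Rightarrow> bool) \<Rightarrow> ('a \<Rightarrow> 'a \<Rightarrow> ennreal) \<Rightarrow> bool" where
  "intrinsic le \<tau> \<longleftrightarrow>
     (\<forall>x y. \<tau> x y = Sup ({0} \<union> {tau_length \<tau> a b \<gamma> | a b \<gamma>. causal_curve_from_to le x y a b \<gamma>}))"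


section \<open>Lorentzian Hausdorff measures\<close>

definition causal_diamond :: "('a \<Rightarrow> 'a \<Rightarrow> bool) \<Rightarrow> 'a \<Rightarrow> 'a \<Rightarrow> 'a set" where
  "causal_diamond le p q = {z. le p z \<and> le z q}"

definition omega_const :: "real \<Rightarrow> real" where
  "omega_const s = pi powr ((s - 1) / 2) / (s * Gamma ((s + 1) / 2) * 2 powr (s - 1))"

text \<open>Used for \<open>s > 0\<close> only, where \<open>0\<^sup>s = 0\<close> and \<open>\<infinity>\<^sup>s = \<infinity>\<close>.\<close>

definition ennreal_powr :: "ennreal \<Rightarrow> real \<Rightarrow> ennreal" where
  "ennreal_powr x s = (if x = \<infinity> then \<infinity> else ennreal (enn2real x powr s))"

text \<open>
  Index sets are arbitrary, possibly finite or empty, subsets of \<open>\<nat>\<close>. Boundedness is required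
  separately because \<^const>\<open>diameter\<close> is real-valued and unspecified on unbounded sets.
\<close>

definition diamond_cover ::
    "('a::metric_space \<Rightarrow> 'a \<Rightarrow> bool) \<Rightarrow> real \<Rightarrow> 'a set \<Rightarrow> nat set \<Rightarrow> (nat \<Rightarrow> 'a) \<Rightarrow> (nat \<Rightarrow> 'a) \<Rightarrow> bool" where
  "diamond_cover le \<delta> E I p q \<longleftrightarrow>
     E \<subseteq> (\<Union>i\<in>I. causal_diamond le (p i) (q i)) \<and>
     (\<forall>i\<in>I. bounded (causal_diamond le (p i) (q i)) \<and> diameter (causal_diamond le (p i) (q i)) < \<delta>)"

definition hausdorff_pre ::
    "('a::metric_space \<Rightarrow> 'a \<Rightarrow> bool) \<Rightarrow> ('a \<Rightarrow> 'a \<Rightarrow> ennreal) \<Rightarrow> real \<Rightarrow> real \<Rightarrow> 'a set \<Rightarrow> ennreal" where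
  "hausdorff_pre le \<theta> s \<delta> E =
     Inf {\<Sum>\<^sub>\<infinity>i\<in>I. ennreal (omega_const s) * ennreal_powr (\<theta> (p i) (q i)) s | I p q.
            diamond_cover le \<delta> E I p q}"

definition hausdorff_set_fun ::
    "('a::metric_space \<Rightarrow> 'a \<Rightarrow> bool) \<Rightarrow> ('a \<Rightarrow> 'a \<Rightarrow> ennreal) \<Rightarrow> real \<Rightarrow> 'a set \<Rightarrow> ennreal" where
  "hausdorff_set_fun le \<theta> s E = Lim (at_right 0) (\<lambda>\<delta>. hausdorff_pre le \<theta> s \<delta> E)"

definition hausdorff_measure ::
    "('a::metric_space \<Rightarrow> 'a \<Rightarrow> bool) \<Rightarrow> ('a \<Rightarrow> 'a \<Rightarrow> ennreal) \<Rightarrow> real \<Rightarrow> 'a measure" where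
  "hausdorff_measure le \<theta> s = measure_of UNIV (sets borel) (hausdorff_set_fun le \<theta> s)"


subsection \<open>The Hausdorff set functions are Borel measures\<close>

lemma summable_on_ennreal_valued [simp]: "f summable_on S" for f :: "'b \<Rightarrow> ennreal"
  by (rule nonneg_summable_on_complete) simp

lemma infsum_ennreal_nat:
  fixes f :: "nat \<Rightarrow> ennreal"
  shows "infsum f I = (\<Sum>n. if n \<in> I then f n else 0)"
proof -
  have "infsum f I = infsum (\<lambda>n. if n \<in> I then f n else 0) UNIV"
    by (rule infsum_cong_neutral) auto
  also have "\<dots> = (\<Sum>n. if n \<in> I then f n else 0)"
    by (rule sums_unique[OF has_sum_imp_sums[OF has_sum_infsum[OF summable_on_ennreal_valued]]])
  finally show ?thesis .
qed

lemma diamond_cover_mono: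
  "diamond_cover le \<delta> F I p q \<Longrightarrow> E \<subseteq> F \<Longrightarrow> \<delta> \<le> \<delta>' \<Longrightarrow> diamond_cover le \<delta>' E I p q"
  unfolding diamond_cover_def by (meson order_less_le_trans order_trans)

lemma hausdorff_pre_mono: "E \<subseteq> F \<Longrightarrow> hausdorff_pre le \<theta> s \<delta> E \<le> hausdorff_pre le \<theta> s \<delta> F"
  unfolding hausdorff_pre_def
  by (rule Inf_superset_mono) (use diamond_cover_mono[OF _ _ order_refl] in blast)

lemma hausdorff_pre_antimono:
  "\<delta> \<le> \<delta>' \<Longrightarrow> hausdorff_pre le \<theta> s \<delta>' E \<le> hausdorff_pre le \<theta> s \<delta> E"
  unfolding hausdorff_pre_def
  by (rule Inf_superset_mono) (use diamond_cover_mono[OF _ order_refl] in blast)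

lemma hausdorff_pre_empty: "hausdorff_pre le \<theta> s \<delta> {} = 0"
proof -
  have "hausdorff_pre le \<theta> s \<delta> {} \<le> 0"
    unfolding hausdorff_pre_def
  proof (rule Inf_lower)
    have "diamond_cover le \<delta> {} {} p q" for p q
      by (simp add: diamond_cover_def)
    then show "0 \<in> {\<Sum>\<^sub>\<infinity>i\<in>I. ennreal (omega_const s) * ennreal_powr (\<theta> (p i) (q i)) s |I p q.
        diamond_cover le \<delta> {} I p q}"
      by (force intro: infsum_empty[symmetric])
  qed
  then show ?thesis by simp
qed

lemma hausdorff_pre_countable_subadditive:
  "hausdorff_pre le \<theta> s \<delta> (\<Union>n. A n) \<le> (\<Sum>n. hausdorff_pre le \<theta> s \<delta> (A n))"
    (is "?L \<le> ?R")
proof (rule ennreal_le_epsilon)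
  fix e :: real
  assume "?R < top" and e: "0 < e"
  then have fin: "hausdorff_pre le \<theta> s \<delta> (A n) < top" for n
    by (metis ennreal_suminf_lessD infinity_ennreal_def)
  define w where "w a b = ennreal (omega_const s) * ennreal_powr (\<theta> a b) s" for a b
  define ee where "ee n = ennreal (e * (1/2) ^ Suc n)" for n
  have "\<exists>I p q. diamond_cover le \<delta> (A n) I p q \<and>
          (\<Sum>\<^sub>\<infinity>i\<in>I. w (p i) (q i)) < hausdorff_pre le \<theta> s \<delta> (A n) + ee n" for n
  proof -
    have "0 < ee n" using e by (simp add: ee_def)
    then have "hausdorff_pre le \<theta> s \<delta> (A n) < hausdorff_pre le \<theta> s \<delta> (A n) + ee n"
      using fin[of n] by (metis add.right_neutral ennreal_add_left_cancel_less infinity_ennreal_def less_irrefl)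
    then show ?thesis
      unfolding hausdorff_pre_def[of le \<theta> s \<delta> "A n"] Inf_less_iff w_def by blast
  qed
  then obtain I p q where cov: "\<And>n. diamond_cover le \<delta> (A n) (I n) (p n) (q n)"
    and sm: "\<And>n. (\<Sum>\<^sub>\<infinity>i\<in>I n. w (p n i) (q n i)) < hausdorff_pre le \<theta> s \<delta> (A n) + ee n"
    by metis
  define f where "f = (\<lambda>(m,n). if n \<in> I m then w (p m n) (q m n) else 0)"
  define K where "K = {k. case prod_decode k of (m,n) \<Rightarrow> n \<in> I m}"
  define P where "P k = (case prod_decode k of (m,n) \<Rightarrow> p m n)" for k
  define Q where "Q k = (case prod_decode k of (m,n) \<Rightarrow> q m n)" for k
  have dc: "diamond_cover le \<delta> (\<Union>n. A n) K P Q"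
    unfolding diamond_cover_def
  proof (intro conjI ballI subsetI)
    fix x assume "x \<in> (\<Union>n. A n)"
    then obtain m n where "n \<in> I m" "x \<in> causal_diamond le (p m n) (q m n)"
      using cov unfolding diamond_cover_def by blast
    then show "x \<in> (\<Union>i\<in>K. causal_diamond le (P i) (Q i))"
      by (intro UN_I[of "prod_encode (m,n)"]) (auto simp: K_def P_def Q_def)
  next
    fix i assume "i \<in> K"
    then show "bounded (causal_diamond le (P i) (Q i))" "diameter (causal_diamond le (P i) (Q i)) < \<delta>"
      using cov unfolding diamond_cover_def K_def P_def Q_def
      by (auto split: prod.splits)
  qed
  have "?L \<le> (\<Sum>\<^sub>\<infinity>i\<in>K. w (P i) (Q i))"
    unfolding hausdorff_pre_def w_def by (rule Inf_lower) (use dc in blast)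
  also have "\<dots> = (\<Sum>k. f (prod_decode k))"
    unfolding infsum_ennreal_nat
    by (rule suminf_cong) (auto simp: f_def K_def P_def Q_def split: prod.splits)
  also have "\<dots> = (\<Sum>m. \<Sum>n. f (m, n))"
    by (rule suminf_ennreal_2dimen) simp
  also have "\<dots> = (\<Sum>m. \<Sum>\<^sub>\<infinity>i\<in>I m. w (p m i) (q m i))"
    by (simp add: infsum_ennreal_nat f_def)
  also have "\<dots> \<le> (\<Sum>m. hausdorff_pre le \<theta> s \<delta> (A m) + ee m)"
    by (rule suminf_le) (use sm in \<open>auto intro: less_imp_le\<close>)
  also have "\<dots> = ?R + (\<Sum>m. ee m)"
    by (rule suminf_add[symmetric]) auto
  also have "(\<Sum>m. ee m) = ennreal e"
  proof -
    have "(\<lambda>m. e * (1/2) ^ Suc m) sums (e * 1)"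
      by (rule sums_mult[OF power_half_series])
    then show ?thesis
      unfolding ee_def using e by (intro suminf_ennreal_eq) auto
  qed
  finally show "?L \<le> ?R + ennreal e" .
qed

lemma hausdorff_pre_metric:
  fixes le :: "'a::metric_space \<Rightarrow> 'a \<Rightarrow> bool"
  assumes sep: "\<And>x y. x \<in> A \<Longrightarrow> y \<in> B \<Longrightarrow> \<delta> \<le> dist x y"
  shows "hausdorff_pre le \<theta> s \<delta> A + hausdorff_pre le \<theta> s \<delta> B \<le> hausdorff_pre le \<theta> s \<delta> (A \<union> B)"
proof -
  define w where "w a b = ennreal (omega_const s) * ennreal_powr (\<theta> a b) s" for a b
  have "hausdorff_pre le \<theta> s \<delta> A + hausdorff_pre le \<theta> s \<delta> B \<le> (\<Sum>\<^sub>\<infinity>i\<in>I. w (p i) (q i))"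
    if cov: "diamond_cover le \<delta> (A \<union> B) I p q" for I p q
  proof -
    let ?J = "\<lambda>i. causal_diamond le (p i) (q i)"
    define I1 where "I1 = {i\<in>I. ?J i \<inter> A \<noteq> {}}"
    define I2 where "I2 = {i\<in>I. ?J i \<inter> B \<noteq> {}}"
    have disj: "I1 \<inter> I2 = {}"
    proof (rule ccontr)
      assume "I1 \<inter> I2 \<noteq> {}"
      then obtain i x y where i: "i \<in> I" "x \<in> ?J i" "x \<in> A" "y \<in> ?J i" "y \<in> B"
        unfolding I1_def I2_def by blast
      then have "dist x y \<le> diameter (?J i)" "diameter (?J i) < \<delta>"
        using cov diameter_bounded_bound unfolding diamond_cover_def by blast+
      then show False using sep[OF i(3,5)] by linarith
    qed
    have "hausdorff_pre le \<theta> s \<delta> A \<le> (\<Sum>\<^sub>\<infinity>i\<in>I1. w (p i) (q i))"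
      unfolding hausdorff_pre_def w_def
    proof (rule Inf_lower)
      have "diamond_cover le \<delta> A I1 p q"
        using cov unfolding diamond_cover_def I1_def by blast
      then show "(\<Sum>\<^sub>\<infinity>i\<in>I1. ennreal (omega_const s) * ennreal_powr (\<theta> (p i) (q i)) s) \<in>
        {\<Sum>\<^sub>\<infinity>i\<in>I. ennreal (omega_const s) * ennreal_powr (\<theta> (p i) (q i)) s |I p q. diamond_cover le \<delta> A I p q}"
        by blast
    qed
    moreover have "hausdorff_pre le \<theta> s \<delta> B \<le> (\<Sum>\<^sub>\<infinity>i\<in>I2. w (p i) (q i))"
      unfolding hausdorff_pre_def w_def
    proof (rule Inf_lower)
      have "diamond_cover le \<delta> B I2 p q"
        using cov unfolding diamond_cover_def I2_def by blast
      then show "(\<Sum>\<^sub>\<infinity>i\<in>I2. ennreal (omega_const s) * ennreal_powr (\<theta> (p i) (q i)) s) \<in>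
        {\<Sum>\<^sub>\<infinity>i\<in>I. ennreal (omega_const s) * ennreal_powr (\<theta> (p i) (q i)) s |I p q. diamond_cover le \<delta> B I p q}"
        by blast
    qed
    ultimately have "hausdorff_pre le \<theta> s \<delta> A + hausdorff_pre le \<theta> s \<delta> B
        \<le> (\<Sum>\<^sub>\<infinity>i\<in>I1. w (p i) (q i)) + (\<Sum>\<^sub>\<infinity>i\<in>I2. w (p i) (q i))"
      by (rule add_mono)
    also have "\<dots> = (\<Sum>\<^sub>\<infinity>i\<in>I1 \<union> I2. w (p i) (q i))"
      by (rule infsum_Un_disjoint[symmetric]) (use disj in auto)
    also have "\<dots> \<le> (\<Sum>\<^sub>\<infinity>i\<in>I. w (p i) (q i))"
      by (rule infsum_mono_neutral) (auto simp: I1_def I2_def)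
    finally show ?thesis .
  qed
  then show ?thesis
    unfolding hausdorff_pre_def[of le \<theta> s \<delta> "A \<union> B"] w_def by (intro Inf_greatest) auto
qed

lemma hausdorff_pre_tendsto:
  "((\<lambda>\<delta>. hausdorff_pre le \<theta> s \<delta> E) \<longlongrightarrow> (SUP \<delta>\<in>{0<..}. hausdorff_pre le \<theta> s \<delta> E)) (at_right 0)"
proof (rule order_tendstoI)
  fix c assume "c < (SUP \<delta>\<in>{0<..}. hausdorff_pre le \<theta> s \<delta> E)"
  then obtain d where d: "0 < d" "c < hausdorff_pre le \<theta> s d E"
    by (auto simp: less_SUP_iff)
  show "\<forall>\<^sub>F \<delta> in at_right 0. c < hausdorff_pre le \<theta> s \<delta> E"
    unfolding eventually_at_right_field
    using d by (intro exI[of _ d]) (auto intro: less_le_trans[OF _ hausdorff_pre_antimono[OF less_imp_le]])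
next
  fix c assume "(SUP \<delta>\<in>{0<..}. hausdorff_pre le \<theta> s \<delta> E) < c"
  then show "\<forall>\<^sub>F \<delta> in at_right 0. hausdorff_pre le \<theta> s \<delta> E < c"
    unfolding eventually_at_right_field
    by (intro exI[of _ 1]) (auto dest!: SUP_lessD)
qed

lemma hausdorff_set_fun_eq_SUP:
  "hausdorff_set_fun le \<theta> s E = (SUP \<delta>\<in>{0<..}. hausdorff_pre le \<theta> s \<delta> E)"
  unfolding hausdorff_set_fun_def
  by (rule tendsto_Lim[OF _ hausdorff_pre_tendsto]) simp

lemma hausdorff_set_fun_mono: "E \<subseteq> F \<Longrightarrow> hausdorff_set_fun le \<theta> s E \<le> hausdorff_set_fun le \<theta> s F"
  unfolding hausdorff_set_fun_eq_SUP by (intro SUP_mono') (rule hausdorff_pre_mono)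

lemma hausdorff_set_fun_empty: "hausdorff_set_fun le \<theta> s {} = 0"
  unfolding hausdorff_set_fun_eq_SUP by (auto simp: hausdorff_pre_empty)

lemma hausdorff_set_fun_countable_subadditive:
  "hausdorff_set_fun le \<theta> s (\<Union>n. A n) \<le> (\<Sum>n. hausdorff_set_fun le \<theta> s (A n))"
proof -
  have "hausdorff_pre le \<theta> s \<delta> (\<Union>n. A n) \<le> (\<Sum>n. hausdorff_set_fun le \<theta> s (A n))" if "\<delta> > 0" for \<delta>
  proof -
    have "hausdorff_pre le \<theta> s \<delta> (\<Union>n. A n) \<le> (\<Sum>n. hausdorff_pre le \<theta> s \<delta> (A n))"
      by (rule hausdorff_pre_countable_subadditive)
    also have "\<dots> \<le> (\<Sum>n. hausdorff_set_fun le \<theta> s (A n))"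
      unfolding hausdorff_set_fun_eq_SUP using that by (intro suminf_le SUP_upper) auto
    finally show ?thesis .
  qed
  then show ?thesis
    unfolding hausdorff_set_fun_eq_SUP[of _ _ _ "\<Union>n. A n"] by (intro SUP_least) auto
qed

lemma hausdorff_outer_measure: "outer_measure_space (Pow UNIV) (hausdorff_set_fun le \<theta> s)"
  unfolding outer_measure_space_def positive_def increasing_def countably_subadditive_def
  by (auto simp: hausdorff_set_fun_empty hausdorff_set_fun_mono hausdorff_set_fun_countable_subadditive)

lemma hausdorff_set_fun_subadditive:
  "hausdorff_set_fun le \<theta> s (A \<union> B) \<le> hausdorff_set_fun le \<theta> s A + hausdorff_set_fun le \<theta> s B"
proof -
  let ?h = "hausdorff_set_fun le \<theta> s"
  have "?h (A \<union> B) = ?h (\<Union>n. binaryset A B n)" by (simp add: UN_binaryset_eq)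
  also have "\<dots> \<le> (\<Sum>n. ?h (binaryset A B n))"
    by (rule hausdorff_set_fun_countable_subadditive)
  also have "\<dots> = ?h A + ?h B"
    by (rule suminf_binaryset_eq) (rule hausdorff_set_fun_empty)
  finally show ?thesis .
qed

lemma hausdorff_set_fun_metric:
  fixes le :: "'a::metric_space \<Rightarrow> 'a \<Rightarrow> bool"
  assumes "0 < \<eta>" and sep: "\<And>x y. x \<in> A \<Longrightarrow> y \<in> B \<Longrightarrow> \<eta> \<le> dist x y"
  shows "hausdorff_set_fun le \<theta> s A + hausdorff_set_fun le \<theta> s B \<le> hausdorff_set_fun le \<theta> s (A \<union> B)"
proof (rule tendsto_le[of "at_right (0::real)"])
  let ?H = "\<lambda>E \<delta>. hausdorff_pre le \<theta> s \<delta> E"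
  have lim: "(?H E \<longlongrightarrow> hausdorff_set_fun le \<theta> s E) (at_right 0)" for E
    unfolding hausdorff_set_fun_eq_SUP by (rule hausdorff_pre_tendsto)
  show "((\<lambda>\<delta>. ?H A \<delta> + ?H B \<delta>) \<longlongrightarrow>
      hausdorff_set_fun le \<theta> s A + hausdorff_set_fun le \<theta> s B) (at_right 0)"
    by (intro tendsto_add lim)
  show "(?H (A \<union> B) \<longlongrightarrow> hausdorff_set_fun le \<theta> s (A \<union> B)) (at_right 0)"
    by (rule lim)
  show "\<forall>\<^sub>F \<delta> in at_right 0. ?H A \<delta> + ?H B \<delta> \<le> ?H (A \<union> B) \<delta>"
    unfolding eventually_at_right_field
  proof (intro exI[of _ \<eta>] conjI allI impI)
    fix y assume "0 < y" "y < \<eta>"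
    then show "?H A y + ?H B y \<le> ?H (A \<union> B) y"
      by (intro hausdorff_pre_metric) (use sep in force)
  qed (use assms in auto)
qed simp

text \<open>Caratheodory's criterion for the metric outer measure \<^const>\<open>hausdorff_set_fun\<close>.\<close>

lemma hausdorff_closed_measurable:
  fixes le :: "'a::metric_space \<Rightarrow> 'a \<Rightarrow> bool"
  assumes C: "closed C"
  shows "hausdorff_set_fun le \<theta> s (T \<inter> C) + hausdorff_set_fun le \<theta> s (T - C) \<le> hausdorff_set_fun le \<theta> s T"
proof (cases "C = {} \<or> hausdorff_set_fun le \<theta> s T = top")
  case True
  then show ?thesis by (auto simp: hausdorff_set_fun_empty)
next
  case False
  then have Cne: "C \<noteq> {}" and fin: "hausdorff_set_fun le \<theta> s T < top"
    by (auto simp: less_top)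
  let ?h = "hausdorff_set_fun le \<theta> s"
  define r where "r n = 1 / real (Suc n)" for n
  have r_pos: "0 < r n" for n by (simp add: r_def)
  have r_less: "r (Suc n) < r n" for n by (simp add: r_def field_simps)
  have r_mono: "m \<le> n \<Longrightarrow> r n \<le> r m" for m n by (simp add: r_def field_simps)
  define D where "D n = {x\<in>T. r n \<le> infdist x C}" for n
  define R where "R n = D (Suc n) - D n" for n
  have D_mono: "m \<le> n \<Longrightarrow> D m \<subseteq> D n" for m n
    using r_mono[of m n] unfolding D_def by auto
  have D_T: "D n \<subseteq> T" for n by (auto simp: D_def)
  have TC: "T - C \<subseteq> (\<Union>n. D n)"
  proof
    fix x assume x: "x \<in> T - C"
    then have "0 < infdist x C"
      using C Cne by (simp add: infdist_pos_not_in_closed)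
    then obtain n where "r n < infdist x C"
      unfolding r_def using nat_approx_posE by metis
    then show "x \<in> (\<Union>n. D n)" using x by (auto simp: D_def intro!: exI[of _ n])
  qed
  have far: "r m - r n \<le> dist x y" if "r m \<le> infdist x C" "infdist y C \<le> r n" for m n x y
    using that infdist_triangle[of x C y] by linarith
  have step: "?h (R (Suc k)) + ?h B \<le> ?h (R (Suc k) \<union> B)" if "B \<subseteq> D k" for k B
  proof -
    have "?h B + ?h (R (Suc k)) \<le> ?h (B \<union> R (Suc k))"
    proof (rule hausdorff_set_fun_metric)
      show "0 < r k - r (Suc k)" using r_less[of k] by simp
      fix x y assume "x \<in> B" "y \<in> R (Suc k)"
      then show "r k - r (Suc k) \<le> dist x y"
        using that by (intro far) (auto simp: D_def R_def)
    qed
    then show ?thesis by (simp add: add.commute Un_commute)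
  qed
  have R_D: "R k \<subseteq> D (Suc k)" for k by (auto simp: R_def)
  have alt: "(\<Sum>k<n. ?h (R (2 * k + j))) \<le> ?h (\<Union>k<n. R (2 * k + j))" for n j
  proof (induction n)
    case 0 show ?case by simp
  next
    case (Suc n)
    show ?case
    proof (cases "2 * n + j")
      case 0
      then show ?thesis by (simp add: lessThan_Suc)
    next
      case (Suc l)
      let ?B = "\<Union>k<n. R (2 * k + j)"
      have "?B \<subseteq> D l"
      proof
        fix x assume "x \<in> ?B"
        then obtain k where "k < n" "x \<in> R (2 * k + j)" by blast
        moreover from \<open>k < n\<close> Suc have "Suc (2 * k + j) \<le> l" by linarith
        ultimately show "x \<in> D l" using R_D D_mono by blast
      qed
      then have "?h (R (2 * n + j)) + ?h ?B \<le> ?h (R (2 * n + j) \<union> ?B)"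
        using step[of ?B l] Suc by simp
      then have "?h (R (2 * n + j)) + (\<Sum>k<n. ?h (R (2 * k + j))) \<le> ?h (R (2 * n + j) \<union> ?B)"
        using Suc.IH by (meson add_left_mono order_trans)
      then show ?thesis
        by (simp add: lessThan_Suc add.commute)
    qed
  qed
  have altT: "(\<Sum>k<n. ?h (R (2 * k + j))) \<le> ?h T" for n j
    using alt[where n=n and j=j] hausdorff_set_fun_mono[of "\<Union>k<n. R (2 * k + j)" T] R_D D_T
    by (meson UN_least order_trans)
  have pairs: "(\<Sum>k<2*n. ?h (R k)) = (\<Sum>k<n. ?h (R (2 * k + 0))) + (\<Sum>k<n. ?h (R (2 * k + 1)))" for n
    by (induction n) (auto simp: algebra_simps)
  have part: "(\<Sum>k<n. ?h (R k)) \<le> ?h T + ?h T" for n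
  proof -
    have "(\<Sum>k<n. ?h (R k)) \<le> (\<Sum>k<2*n. ?h (R k))"
      by (rule sum_mono2) auto
    also have "\<dots> \<le> ?h T + ?h T"
      unfolding pairs by (intro add_mono altT)
    finally show ?thesis .
  qed
  have sumfin: "(\<Sum>k. ?h (R k)) < top"
  proof -
    have "(\<Sum>k. ?h (R k)) \<le> ?h T + ?h T"
      by (rule suminf_le_const[OF summableI part])
    also have "\<dots> < top" using fin by simp
    finally show ?thesis .
  qed
  have tail0: "(\<lambda>n. \<Sum>k. ?h (R (k + n))) \<longlonglongrightarrow> 0"
  proof -
    let ?S = "\<Sum>k. ?h (R k)" and ?P = "\<lambda>n. \<Sum>k<n. ?h (R k)"
    have le: "?P n \<le> ?S" for n by (rule sum_le_suminf) auto
    have "(\<Sum>k. ?h (R (k + n))) = ?S - ?P n" for n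
    proof -
      have "?S = (\<Sum>k. ?h (R (k + n))) + ?P n" by (rule suminf_offset) simp
      moreover have "?P n \<noteq> top" by (rule less_imp_neq[OF le_less_trans[OF le sumfin]])
      ultimately show ?thesis by (metis ennreal_add_diff_cancel_right infinity_ennreal_def)
    qed
    moreover have "(\<lambda>n. ?S - ?P n) \<longlonglongrightarrow> ?S - ?S"
      using sumfin by (intro tendsto_diff_ennreal tendsto_const summable_LIMSEQ) auto
    moreover have "?S - ?S = 0" using sumfin by simp
    ultimately show ?thesis by simp
  qed
  have main: "?h (T \<inter> C) + ?h (T - C) \<le> ?h T + (\<Sum>k. ?h (R (k + n)))" for n
  proof -
    have "T - C \<subseteq> D n \<union> (\<Union>k. R (k + n))"
    proof
      fix x assume "x \<in> T - C"
      then obtain m where m: "x \<in> D m" using TC by blast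
      show "x \<in> D n \<union> (\<Union>k. R (k + n))"
      proof (cases "x \<in> D n")
        case False
        define l where "l = (LEAST m. x \<in> D m)"
        have l: "x \<in> D l" "\<And>i. i < l \<Longrightarrow> x \<notin> D i"
          unfolding l_def using m LeastI not_less_Least by metis+
        have "n < l" using False l(1) D_mono[of l n] by (meson linorder_not_le subsetD)
        then have "x \<in> R (l - 1)" and "l - 1 = (l - 1 - n) + n"
          using l by (auto simp: R_def)
        then show ?thesis by (metis UN_I UNIV_I UnI2)
      qed simp
    qed
    then have "?h (T - C) \<le> ?h (D n \<union> (\<Union>k. R (k + n)))"
      by (rule hausdorff_set_fun_mono)
    also have "\<dots> \<le> ?h (D n) + ?h (\<Union>k. R (k + n))"
      by (rule hausdorff_set_fun_subadditive)
    also have "\<dots> \<le> ?h (D n) + (\<Sum>k. ?h (R (k + n)))"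
      by (intro add_left_mono hausdorff_set_fun_countable_subadditive)
    finally have "?h (T \<inter> C) + ?h (T - C) \<le> (?h (T \<inter> C) + ?h (D n)) + (\<Sum>k. ?h (R (k + n)))"
      by (metis add.assoc add_left_mono)
    moreover have "?h (T \<inter> C) + ?h (D n) \<le> ?h T"
    proof -
      have "?h (T \<inter> C) + ?h (D n) \<le> ?h (T \<inter> C \<union> D n)"
      proof (rule hausdorff_set_fun_metric[OF r_pos[of n]])
        fix x y assume "x \<in> T \<inter> C" "y \<in> D n"
        then have "infdist y C \<le> dist y x" "r n \<le> infdist y C"
          by (auto simp: D_def intro: infdist_le)
        then show "r n \<le> dist x y" by (simp add: dist_commute)
      qed
      also have "\<dots> \<le> ?h T"
        by (rule hausdorff_set_fun_mono) (use D_T in auto)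
      finally show ?thesis .
    qed
    ultimately show ?thesis by (meson add_right_mono order_trans)
  qed
  have "(\<lambda>n. ?h T + (\<Sum>k. ?h (R (k + n)))) \<longlonglongrightarrow> ?h T + 0"
    by (intro tendsto_add tendsto_const tail0)
  then have "?h (T \<inter> C) + ?h (T - C) \<le> ?h T + 0"
    by (rule LIMSEQ_le_const) (use main in blast)
  then show ?thesis by simp
qed

lemma measure_space_hausdorff:
  "measure_space UNIV (sets borel) (hausdorff_set_fun le \<theta> s)"
proof -
  interpret P: sigma_algebra UNIV "Pow UNIV :: 'a set set" by (rule sigma_algebra_Pow)
  let ?h = "hausdorff_set_fun le \<theta> s"
  let ?L = "lambda_system UNIV (Pow UNIV) ?h"
  have L: "measure_space UNIV ?L ?h"
    by (rule P.caratheodory_lemma[OF hausdorff_outer_measure])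
  then interpret L: sigma_algebra UNIV ?L by (simp add: measure_space_def)
  have "C \<in> ?L" if "closed C" for C
  proof -
    have "?h (T \<inter> C) + ?h (T - C) = ?h T" for T
      using hausdorff_closed_measurable[OF that] hausdorff_set_fun_subadditive[of le \<theta> s "T \<inter> C" "T - C"]
      by (metis Int_Diff_Un antisym)
    then show ?thesis unfolding P.lambda_system_eq by blast
  qed
  then have "sigma_sets UNIV (Collect closed) \<subseteq> ?L"
    by (intro L.sigma_sets_subset) auto
  then have sub: "sets borel \<subseteq> ?L"
    by (simp add: borel_eq_closed)
  show ?thesis
  proof (rule measure_down[OF L])
    show "sigma_algebra UNIV (sets (borel :: 'a measure))"
      using sets.sigma_algebra_axioms[of "borel :: 'a measure"] by (simp only: space_borel)
  qed (rule sub)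
qed

lemma space_hausdorff_measure [simp]: "space (hausdorff_measure le \<theta> s) = UNIV"
  by (simp add: hausdorff_measure_def space_measure_of_conv)

lemma sets_hausdorff_measure [simp, measurable_cong]: "sets (hausdorff_measure le \<theta> s) = sets borel"
  unfolding hausdorff_measure_def
  using sets.sigma_sets_eq[of "borel :: 'a::metric_space measure"] by (simp add: sets_measure_of)

lemma emeasure_hausdorff_measure:
  "E \<in> sets borel \<Longrightarrow> emeasure (hausdorff_measure le \<theta> s) E = hausdorff_set_fun le \<theta> s E"
  unfolding hausdorff_measure_def
  using measure_space_hausdorff[of le \<theta> s]
  by (intro emeasure_measure_of_sigma) (auto simp: measure_space_def)

end

theory Submission
  imports Defs
begin

text \<open>
  The identity is local. If \<open>a \<le> \<Omega> \<le> b\<close> on a causal diamond \<open>J(p,q)\<close>, then, since every causal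
  curve from \<open>p\<close> to \<open>q\<close> stays in \<open>J(p,q)\<close>, all its \<open>\<Omega>\<close>-lengths lie between \<open>a\<close> and \<open>b\<close> times
  its \<open>\<tau>\<close>-length. Taking suprema over curves, and using that \<open>\<tau>\<close> is itself such a supremum because
  the space is intrinsic, gives \<open>a \<tau>(p,q) \<le> \<tau>\<^sub>\<Omega>(p,q) \<le> b \<tau>(p,q)\<close> (lemma \<open>conf_tau_le_mult\<close>).

  Both Hausdorff measures use covers by the same diamonds, and only diamonds of small diameter that
  meet the given set matter. Hence \<open>a\<^sup>s H\<^sub>\<tau>(A) \<le> H\<^sub>\<tau>\<^sub>\<Omega>(A) \<le> b\<^sup>s H\<^sub>\<tau>(A)\<close> as soon as
  \<open>a \<le> \<Omega> \<le> b\<close> on an \<open>r\<close>-neighbourhood of \<open>A\<close> for some \<open>r > 0\<close> (lemma \<open>hausdorff_conf_tau_le_mult\<close>).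
  The same bounds hold trivially for the integral of \<open>\<Omega>\<^sup>s\<close> over \<open>A\<close>, so on such an \<open>A\<close>
  the two sides of the theorem agree up to the factor \<open>(b/a)\<^sup>s\<close>.

  For a given ratio \<open>t > 1\<close>, continuity of \<open>\<Omega>\<close> lets countably many closed sets of this kind, with
  \<open>b \<le> t a\<close> and rational \<open>a\<close>, \<open>b\<close>, \<open>1/r\<close>, cover the whole space. Both sides being measures, the
  comparison up to \<open>t\<^sup>s\<close> passes to every Borel set, and \<open>t \<rightarrow> 1\<close> gives equality.
\<close>


section \<open>Extended nonnegative reals\<close>

lemma ennreal_le_cmult_Inf:
  fixes x :: ennreal
  assumes "0 < c" and "\<And>y. y \<in> S \<Longrightarrow> x \<le> ennreal c * y"
  shows "x \<le> ennreal c * Inf S"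
proof -
  have inv: "ennreal (1 / c) * (ennreal c * y) = y" "ennreal c * (ennreal (1 / c) * y) = y" for y
    using \<open>0 < c\<close> by (simp_all flip: mult.assoc ennreal_mult)
  have "ennreal (1 / c) * x \<le> Inf S"
  proof (rule Inf_greatest)
    fix y assume "y \<in> S"
    then have "ennreal (1 / c) * x \<le> ennreal (1 / c) * (ennreal c * y)"
      by (intro mult_left_mono assms) auto
    then show "ennreal (1 / c) * x \<le> y" by (simp add: inv)
  qed
  then have "ennreal c * (ennreal (1 / c) * x) \<le> ennreal c * Inf S"
    by (rule mult_left_mono) simp
  then show ?thesis by (simp add: inv)
qed

lemma ennreal_le_if_le_mult_gt_1:
  fixes x y :: ennreal
  assumes "\<And>t. 1 < t \<Longrightarrow> x \<le> ennreal t * y"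
  shows "x \<le> y"
proof (rule tendsto_lowerbound)
  show "((\<lambda>t. ennreal t * y) \<longlongrightarrow> y) (at_right 1)"
    using tendsto_mult_ennreal[OF tendsto_ennrealI[OF tendsto_ident_at] tendsto_const,
        of 1 y "{1<..}"] by simp
  show "\<forall>\<^sub>F t in at_right 1. x \<le> ennreal t * y"
    using assms by (auto simp: eventually_at_right_field intro: exI[of _ 2])
qed simp

lemma ennreal_powr_le_cmult:
  assumes "0 < s" "0 < c" and le: "x \<le> ennreal c * y"
  shows "ennreal_powr x s \<le> ennreal (c powr s) * ennreal_powr y s"
proof (cases "y = \<infinity>")
  case True
  then show ?thesis using assms by (simp add: ennreal_powr_def ennreal_mult_top)
next
  case False
  then obtain y' where y: "y = ennreal y'" "0 \<le> y'"
    by (cases y) auto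
  then have cy: "x \<le> ennreal (c * y')"
    using le \<open>0 < c\<close> by (simp add: ennreal_mult)
  then obtain x' where x: "x = ennreal x'" "0 \<le> x'"
    by (cases x) (auto simp: top_unique)
  have "x' \<le> c * y'" using cy x y \<open>0 < c\<close> by simp
  then have "x' powr s \<le> c powr s * y' powr s"
    using x y assms by (simp add: powr_mono2 flip: powr_mult)
  then show ?thesis
    using x y assms by (simp add: ennreal_powr_def flip: ennreal_mult)
qed


section \<open>Comparing conformal time separations\<close>

lemma is_partition_mem:
  assumes "is_partition a b m t" "i \<le> m"
  shows "t i \<in> {a..b}"
proof -
  have step: "t k \<le> t (Suc k)" if "k < m" for k
    using assms(1) that by (auto simp: is_partition_def less_imp_le)
  have "t 0 \<le> t i" using assms(2)
    by (induction i) (auto intro: order_trans[OF _ step])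
  moreover have "t i \<le> t m" using assms(2)
    by (induction rule: inc_induct) (auto intro: order_trans[OF step])
  ultimately show ?thesis using assms(1) by (simp add: is_partition_def)
qed

lemma conf_length_le_mult:
  assumes "0 < c"
    and le: "\<And>u. u \<in> {a..b} \<Longrightarrow> \<Omega>\<^sub>1 (\<gamma> u) \<le> c * \<Omega>\<^sub>2 (\<gamma> u)"
    and bdd: "bdd_above ((\<lambda>u. \<Omega>\<^sub>2 (\<gamma> u)) ` {a..b})"
  shows "conf_length \<tau> \<Omega>\<^sub>1 a b \<gamma> \<le> ennreal c * conf_length \<tau> \<Omega>\<^sub>2 a b \<gamma>"
  unfolding conf_length_def[of \<tau> \<Omega>\<^sub>2]
proof (rule ennreal_le_cmult_Inf[OF \<open>0 < c\<close>], clarify)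
  fix m t assume part: "is_partition a b m t"
  let ?S = "\<lambda>\<Omega> i. SUP u\<in>{t i..t (Suc i)}. \<Omega> (\<gamma> u)"
  have sup: "ennreal (?S \<Omega>\<^sub>1 i) \<le> ennreal c * ennreal (?S \<Omega>\<^sub>2 i)" if "i < m" for i
  proof -
    have sub: "{t i..t (Suc i)} \<subseteq> {a..b}"
      using is_partition_mem[OF part, of i] is_partition_mem[OF part, of "Suc i"] that by auto
    have "?S \<Omega>\<^sub>1 i \<le> c * ?S \<Omega>\<^sub>2 i"
    proof (rule cSUP_least)
      show "{t i..t (Suc i)} \<noteq> {}"
        using part that by (auto simp: is_partition_def less_imp_le)
      fix u assume u: "u \<in> {t i..t (Suc i)}"
      have "\<Omega>\<^sub>2 (\<gamma> u) \<le> ?S \<Omega>\<^sub>2 i"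
        by (rule cSUP_upper[OF u bdd_above_mono[OF bdd]]) (use sub in blast)
      then have "c * \<Omega>\<^sub>2 (\<gamma> u) \<le> c * ?S \<Omega>\<^sub>2 i"
        using \<open>0 < c\<close> by simp
      then show "\<Omega>\<^sub>1 (\<gamma> u) \<le> c * ?S \<Omega>\<^sub>2 i"
        using le[of u] sub u by auto
    qed
    then show ?thesis
      using \<open>0 < c\<close> by (metis ennreal_leI ennreal_mult' less_imp_le)
  qed
  have "conf_length \<tau> \<Omega>\<^sub>1 a b \<gamma> \<le> (\<Sum>i<m. ennreal (?S \<Omega>\<^sub>1 i) * \<tau> (\<gamma> (t i)) (\<gamma> (t (Suc i))))"
    unfolding conf_length_def by (rule Inf_lower) (use part in blast)
  also have "\<dots> \<le> (\<Sum>i<m. ennreal c * ennreal (?S \<Omega>\<^sub>2 i) * \<tau> (\<gamma> (t i)) (\<gamma> (t (Suc i))))"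
    by (intro sum_mono mult_right_mono sup) auto
  finally show "conf_length \<tau> \<Omega>\<^sub>1 a b \<gamma>
      \<le> ennreal c * (\<Sum>i<m. ennreal (?S \<Omega>\<^sub>2 i) * \<tau> (\<gamma> (t i)) (\<gamma> (t (Suc i))))"
    by (simp add: sum_distrib_left mult.assoc)
qed

lemma causal_curve_in_diamond:
  assumes "reflp le" "causal_curve_from_to le x y a b \<gamma>" "u \<in> {a..b}"
  shows "\<gamma> u \<in> causal_diamond le x y"
  using assms
  unfolding causal_curve_from_to_def causal_curve_def causal_diamond_def
  by (smt (verit) atLeastAtMost_iff mem_Collect_eq reflpD)

text \<open>
  The causal diamond of \<open>x\<close> and \<open>y\<close> is the region that determines the conformal time separation
  of \<open>x\<close> and \<open>y\<close>, so a comparison of the conformal factors is only needed there.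
\<close>

lemma conf_tau_le_mult:
  assumes "reflp le" "0 < c" "continuous_on UNIV \<Omega>\<^sub>2"
    and le: "\<And>z. z \<in> causal_diamond le x y \<Longrightarrow> \<Omega>\<^sub>1 z \<le> c * \<Omega>\<^sub>2 z"
  shows "conf_tau le \<tau> \<Omega>\<^sub>1 x y \<le> ennreal c * conf_tau le \<tau> \<Omega>\<^sub>2 x y"
  unfolding conf_tau_def[of le \<tau> \<Omega>\<^sub>1]
proof (rule Sup_least, safe)
  fix a b \<gamma> assume \<gamma>: "causal_curve_from_to le x y a b \<gamma>"
  have "continuous_on {a..b} (\<lambda>u. \<Omega>\<^sub>2 (\<gamma> u))"
    using \<gamma> unfolding causal_curve_from_to_def causal_curve_def
    by (intro continuous_on_compose2[OF \<open>continuous_on UNIV \<Omega>\<^sub>2\<close>]) auto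
  then have "bdd_above ((\<lambda>u. \<Omega>\<^sub>2 (\<gamma> u)) ` {a..b})"
    by (intro bounded_imp_bdd_above compact_imp_bounded compact_continuous_image) auto
  then have "conf_length \<tau> \<Omega>\<^sub>1 a b \<gamma> \<le> ennreal c * conf_length \<tau> \<Omega>\<^sub>2 a b \<gamma>"
    using causal_curve_in_diamond[OF \<open>reflp le\<close> \<gamma>]
    by (intro conf_length_le_mult \<open>0 < c\<close> le) auto
  also have "\<dots> \<le> ennreal c * conf_tau le \<tau> \<Omega>\<^sub>2 x y"
    unfolding conf_tau_def by (intro mult_left_mono Sup_upper) (use \<gamma> in auto)
  finally show "conf_length \<tau> \<Omega>\<^sub>1 a b \<gamma> \<le> ennreal c * conf_tau le \<tau> \<Omega>\<^sub>2 x y" .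
qed simp

text \<open>
  This puts \<open>\<tau>\<close> and \<open>\<tau>\<^sub>\<Omega>\<close> on the same footing, so that one comparison lemma yields both the upper
  and the lower bound.
\<close>

lemma intrinsic_eq_conf_tau:
  assumes "intrinsic le \<tau>"
  shows "\<tau> = conf_tau le \<tau> (\<lambda>_. 1)"
  using assms unfolding intrinsic_def conf_tau_def tau_length_def by blast


section \<open>Comparing Hausdorff measures\<close>

text \<open>
  Diamonds of a cover that miss \<open>A\<close> can be discarded, and scales above \<open>r\<close> do not affect the limit.
\<close>

lemma hausdorff_set_fun_le_mult:
  assumes "0 < s" "0 < c" "0 < r"
    and le: "\<And>p q. \<lbrakk>causal_diamond le p q \<inter> A \<noteq> {}; bounded (causal_diamond le p q);
                diameter (causal_diamond le p q) < r\<rbrakk> \<Longrightarrow> \<theta>\<^sub>1 p q \<le> ennreal c * \<theta>\<^sub>2 p q"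
  shows "hausdorff_set_fun le \<theta>\<^sub>1 s A \<le> ennreal (c powr s) * hausdorff_set_fun le \<theta>\<^sub>2 s A"
proof -
  let ?J = "causal_diamond le"
  let ?w = "\<lambda>\<theta> p q. ennreal (omega_const s) * ennreal_powr (\<theta> p q) s"
  have small: "hausdorff_pre le \<theta>\<^sub>1 s \<delta> A \<le> ennreal (c powr s) * hausdorff_pre le \<theta>\<^sub>2 s \<delta> A"
    if "\<delta> \<le> r" for \<delta>
    unfolding hausdorff_pre_def[of le \<theta>\<^sub>2]
  proof (rule ennreal_le_cmult_Inf, use \<open>0 < c\<close> in simp, clarify)
    fix I p q assume cov: "diamond_cover le \<delta> A I p q"
    define I' where "I' = {i\<in>I. ?J (p i) (q i) \<inter> A \<noteq> {}}"
    have cov': "diamond_cover le \<delta> A I' p q"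
      using cov unfolding diamond_cover_def I'_def by blast
    have w: "?w \<theta>\<^sub>1 (p i) (q i) \<le> ennreal (c powr s) * ?w \<theta>\<^sub>2 (p i) (q i)" if "i \<in> I'" for i
    proof -
      have "\<theta>\<^sub>1 (p i) (q i) \<le> ennreal c * \<theta>\<^sub>2 (p i) (q i)"
        using cov that \<open>\<delta> \<le> r\<close> unfolding diamond_cover_def I'_def by (intro le) force+
      then show ?thesis
        using ennreal_powr_le_cmult[OF \<open>0 < s\<close> \<open>0 < c\<close>]
        by (metis (no_types) mult.left_commute mult_left_mono zero_le)
    qed
    have "hausdorff_pre le \<theta>\<^sub>1 s \<delta> A \<le> (\<Sum>\<^sub>\<infinity>i\<in>I'. ?w \<theta>\<^sub>1 (p i) (q i))"
      unfolding hausdorff_pre_def by (rule Inf_lower) (use cov' in blast)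
    also have "\<dots> \<le> (\<Sum>\<^sub>\<infinity>i\<in>I. ennreal (c powr s) * ?w \<theta>\<^sub>2 (p i) (q i))"
      by (rule infsum_mono_neutral) (use w in \<open>auto simp: I'_def\<close>)
    also have "\<dots> = ennreal (c powr s) * (\<Sum>\<^sub>\<infinity>i\<in>I. ?w \<theta>\<^sub>2 (p i) (q i))"
      unfolding infsum_ennreal_nat ennreal_suminf_cmult[symmetric]
      by (rule suminf_cong) simp
    finally show "hausdorff_pre le \<theta>\<^sub>1 s \<delta> A \<le> ennreal (c powr s) * (\<Sum>\<^sub>\<infinity>i\<in>I. ?w \<theta>\<^sub>2 (p i) (q i))" .
  qed
  show ?thesis
    unfolding hausdorff_set_fun_eq_SUP[of le \<theta>\<^sub>1]
  proof (rule SUP_least)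
    fix \<delta> :: real assume "\<delta> \<in> {0<..}"
    have "hausdorff_pre le \<theta>\<^sub>1 s \<delta> A \<le> hausdorff_pre le \<theta>\<^sub>1 s (min \<delta> r) A"
      by (rule hausdorff_pre_antimono) simp
    also have "\<dots> \<le> ennreal (c powr s) * hausdorff_pre le \<theta>\<^sub>2 s (min \<delta> r) A"
      by (rule small) simp
    also have "\<dots> \<le> ennreal (c powr s) * hausdorff_set_fun le \<theta>\<^sub>2 s A"
      unfolding hausdorff_set_fun_eq_SUP
      by (intro mult_left_mono SUP_upper) (use \<open>\<delta> \<in> {0<..}\<close> \<open>0 < r\<close> in auto)
    finally show "hausdorff_pre le \<theta>\<^sub>1 s \<delta> A \<le> ennreal (c powr s) * hausdorff_set_fun le \<theta>\<^sub>2 s A" .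
  qed
qed

text \<open>
  A diamond of diameter less than \<open>r\<close> that meets \<open>A\<close> lies in the \<open>r\<close>-neighbourhood of \<open>A\<close>.
\<close>

lemma hausdorff_conf_tau_le_mult:
  fixes le :: "'a::metric_space \<Rightarrow> 'a \<Rightarrow> bool"
  assumes "reflp le" "0 < s" "0 < c" "0 < r" "continuous_on UNIV \<Omega>\<^sub>2"
    and "A \<in> sets borel"
    and le: "\<And>x y. x \<in> A \<Longrightarrow> dist x y < r \<Longrightarrow> \<Omega>\<^sub>1 y \<le> c * \<Omega>\<^sub>2 y"
  shows "emeasure (hausdorff_measure le (conf_tau le \<tau> \<Omega>\<^sub>1) s) A
      \<le> ennreal (c powr s) * emeasure (hausdorff_measure le (conf_tau le \<tau> \<Omega>\<^sub>2) s) A"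
  unfolding emeasure_hausdorff_measure[OF \<open>A \<in> sets borel\<close>]
proof (rule hausdorff_set_fun_le_mult[OF \<open>0 < s\<close> \<open>0 < c\<close> \<open>0 < r\<close>])
  fix p q
  let ?J = "causal_diamond le p q"
  assume J: "?J \<inter> A \<noteq> {}" "bounded ?J" "diameter ?J < r"
  then obtain x where x: "x \<in> ?J" "x \<in> A" by blast
  have J_le: "\<Omega>\<^sub>1 y \<le> c * \<Omega>\<^sub>2 y" if "y \<in> ?J" for y
    using le[OF x(2)] diameter_bounded_bound[OF J(2) x(1) that] J(3) by simp
  show "conf_tau le \<tau> \<Omega>\<^sub>1 p q \<le> ennreal c * conf_tau le \<tau> \<Omega>\<^sub>2 p q"
    by (rule conf_tau_le_mult[OF \<open>reflp le\<close> \<open>0 < c\<close> \<open>continuous_on UNIV \<Omega>\<^sub>2\<close> J_le])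
qed


section \<open>From local comparison to equality\<close>

lemma emeasure_le_mult_if_locally:
  fixes M N :: "'a measure" and A :: "'i::countable \<Rightarrow> 'a set"
  assumes "sets M = sets N"
    and A: "\<And>i. A i \<in> sets N" "(\<Union>i. A i) = UNIV"
    and le: "\<And>i E. E \<in> sets N \<Longrightarrow> E \<subseteq> A i \<Longrightarrow> emeasure M E \<le> k * emeasure N E"
    and E: "E \<in> sets N"
  shows "emeasure M E \<le> k * emeasure N E"
proof -
  define B where "B n = E \<inter> disjointed (\<lambda>n. A (from_nat n)) n" for n
  have sub: "B n \<subseteq> A (from_nat n)" for n
    using disjointed_subset[of "\<lambda>n. A (from_nat n)" n] by (auto simp: B_def)
  have "range (disjointed (\<lambda>n. A (from_nat n))) \<subseteq> sets N"
    by (rule sets.range_disjointed_sets) (use A(1) in auto)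
  then have B: "B n \<in> sets N" for n
    unfolding B_def by (intro sets.Int E) (rule subsetD[OF _ rangeI])
  have dis: "disjoint_family B"
    using disjoint_family_disjointed[of "\<lambda>n. A (from_nat n)"]
    unfolding B_def disjoint_family_on_def by blast
  have "(\<Union>n. A (from_nat n)) = \<Union> (A ` range from_nat)"
    by (simp only: image_image)
  also have "\<dots> = UNIV"
    by (simp only: surj_from_nat A(2))
  finally have "(\<Union>n. A (from_nat n)) = UNIV" .
  then have UN: "(\<Union>n. B n) = E"
    unfolding B_def by (simp flip: Int_UN_distrib add: UN_disjointed_eq)
  have "emeasure M E = (\<Sum>n. emeasure M (B n))"
    by (subst suminf_emeasure) (use B dis UN \<open>sets M = sets N\<close> in auto)
  also have "\<dots> \<le> (\<Sum>n. k * emeasure N (B n))"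
    by (intro suminf_le le[OF B sub]) auto
  also have "\<dots> = k * emeasure N E"
    using B UN by (subst ennreal_suminf_cmult, subst suminf_emeasure[OF _ dis]) auto
  finally show ?thesis .
qed

lemma closed_ball_contained: "closed {x::'a::metric_space. \<forall>y. dist x y < r \<longrightarrow> y \<in> S}"
proof -
  have "- {x. \<forall>y. dist x y < r \<longrightarrow> y \<in> S} = (\<Union>y\<in>-S. ball y r)"
    by (auto simp: dist_commute)
  moreover have "open (\<Union>y\<in>-S. ball y r)"
    by (intro open_UN ballI open_ball)
  ultimately show ?thesis
    by (simp only: closed_def)
qed

text \<open>
  The space is covered by pieces on which both measures lie between \<open>a\<^sup>s H\<^sub>\<tau>\<close> and \<open>b\<^sup>s H\<^sub>\<tau>\<close> with
  \<open>b \<le> t a\<close>. The pieces are indexed by the rational bounds \<open>a\<close>, \<open>b\<close> for \<open>\<Omega>\<close> and by the radius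
  \<open>1/(n+1)\<close> within which these bounds hold.
\<close>

lemma hausdorff_conf_tau_approx:
  fixes le :: "'a::metric_space \<Rightarrow> 'a \<Rightarrow> bool" and \<tau> :: "'a \<Rightarrow> 'a \<Rightarrow> ennreal" and \<Omega> :: "'a \<Rightarrow> real"
  assumes "reflp le" "intrinsic le \<tau>" "0 < s"
    and cont: "continuous_on UNIV \<Omega>" and pos: "\<And>x. 0 < \<Omega> x"
    and "1 < t" and E: "E \<in> sets borel"
  defines "H \<equiv> hausdorff_measure le \<tau> s"
    and "N \<equiv> hausdorff_measure le (conf_tau le \<tau> \<Omega>) s"
  shows "emeasure N E \<le> ennreal (t powr s) * emeasure (density H (\<lambda>x. \<Omega> x powr s)) E"
    and "emeasure (density H (\<lambda>x. \<Omega> x powr s)) E \<le> ennreal (t powr s) * emeasure N E"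
proof -
  let ?D = "density H (\<lambda>x. \<Omega> x powr s)"
  define A :: "rat \<times> rat \<times> nat \<Rightarrow> 'a set" where
    "A = (\<lambda>(a, b, n). if 0 < a \<and> real_of_rat b \<le> t * real_of_rat a
       then {x. \<forall>y. dist x y < 1 / real (Suc n) \<longrightarrow> \<Omega> y \<in> {real_of_rat a..real_of_rat b}} else {})"
  have [measurable]: "\<Omega> \<in> borel_measurable borel"
    by (rule borel_measurable_continuous_onI[OF cont])
  have sets_H [measurable_cong]: "sets H = sets borel" and sets_N: "sets N = sets borel"
    by (simp_all add: H_def N_def)
  have H_conf: "H = hausdorff_measure le (conf_tau le \<tau> (\<lambda>_. 1)) s"
    unfolding H_def by (rule arg_cong[OF intrinsic_eq_conf_tau[OF \<open>intrinsic le \<tau>\<close>]])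
  have A_borel: "A i \<in> sets borel" for i
    unfolding A_def
    using closed_ball_contained[where S = "\<Omega> -` {real_of_rat a..real_of_rat b}" for a b]
    by (auto split: prod.split intro!: borel_closed)
  have A_cover: "(\<Union>i. A i) = UNIV"
  proof (intro equalityI subsetI UNIV_I)
    fix x
    \<comment> \<open>Bounds within a factor \<open>\<surd>t\<close> of \<open>\<Omega> x\<close> on either side have a ratio of at most \<open>t\<close>.\<close>
    define c where "c = sqrt t"
    have c: "1 < c" "c * c = t" using \<open>1 < t\<close> by (auto simp: c_def)
    have "\<Omega> x / c < \<Omega> x" "\<Omega> x < c * \<Omega> x" using c pos[of x] by (auto simp: field_simps)
    then obtain a b where a: "\<Omega> x / c < real_of_rat a" "real_of_rat a < \<Omega> x"
      and b: "\<Omega> x < real_of_rat b" "real_of_rat b < c * \<Omega> x"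
      using of_rat_dense by meson
    have "0 < \<Omega> x / c" using pos[of x] c by simp
    then have "0 < real_of_rat a" using a by linarith
    moreover have "real_of_rat b \<le> t * real_of_rat a"
    proof -
      have "\<Omega> x \<le> c * real_of_rat a" using a(1) c by (simp add: field_simps)
      then have "c * \<Omega> x \<le> c * (c * real_of_rat a)" using c by simp
      then show ?thesis using b(2) c(2) by (simp flip: mult.assoc)
    qed
    moreover
    have "open (\<Omega> -` {real_of_rat a<..<real_of_rat b})"
      using cont by (simp add: open_vimage)
    then obtain e where "0 < e" and e: "\<And>y. dist x y < e \<Longrightarrow> \<Omega> y \<in> {real_of_rat a<..<real_of_rat b}"
      using a(2) b(1) unfolding open_dist
      by (metis (no_types, lifting) dist_commute greaterThanLessThan_iff vimageE vimageI)
    obtain n where "1 / real (Suc n) < e"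
      using nat_approx_posE[OF \<open>0 < e\<close>] by metis
    then have "\<forall>y. dist x y < 1 / real (Suc n) \<longrightarrow> \<Omega> y \<in> {real_of_rat a..real_of_rat b}"
      using e by (metis atLeastAtMost_iff greaterThanLessThan_iff less_imp_le order.strict_trans)
    ultimately have "x \<in> A (a, b, n)"
      by (simp add: A_def)
    then show "x \<in> (\<Union>i. A i)" by blast
  qed
  have local: "emeasure N F \<le> ennreal (t powr s) * emeasure ?D F
      \<and> emeasure ?D F \<le> ennreal (t powr s) * emeasure N F"
    if F: "F \<in> sets borel" "F \<subseteq> A i" for F i
  proof (cases "F = {}")
    case False
    obtain a b n where i: "i = (a, b, n)" by (cases i)
    define \<alpha> \<beta> where "\<alpha> = real_of_rat a" and "\<beta> = real_of_rat b"
    have ab: "0 < \<alpha>" "\<beta> \<le> t * \<alpha>"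
      and bound: "\<And>x y. x \<in> F \<Longrightarrow> dist x y < 1 / real (Suc n) \<Longrightarrow> \<alpha> \<le> \<Omega> y \<and> \<Omega> y \<le> \<beta>"
      using F(2) False unfolding A_def i \<alpha>_def \<beta>_def by (auto split: if_splits)
    have bound': "\<alpha> \<le> \<Omega> x \<and> \<Omega> x \<le> \<beta>" if "x \<in> F" for x
      using bound[OF that, of x] by simp
    have "0 < \<beta>" using bound' False ab(1) by fastforce
    have \<beta>\<alpha>: "ennreal (\<beta> powr s) \<le> ennreal (t powr s) * ennreal (\<alpha> powr s)"
      using ab \<open>0 < \<beta>\<close> \<open>0 < s\<close> \<open>1 < t\<close>
      by (simp add: powr_mono2 flip: ennreal_mult powr_mult)
    have up: "emeasure N F \<le> ennreal (\<beta> powr s) * emeasure H F"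
      unfolding N_def H_conf
      by (rule hausdorff_conf_tau_le_mult[where r = "1 / real (Suc n)"])
        (use \<open>reflp le\<close> \<open>0 < s\<close> \<open>0 < \<beta>\<close> F(1) bound in auto)
    have "emeasure H F \<le> ennreal ((1 / \<alpha>) powr s) * emeasure N F"
      unfolding N_def H_conf
    proof (rule hausdorff_conf_tau_le_mult[where r = "1 / real (Suc n)"])
      show "1 \<le> 1 / \<alpha> * \<Omega> y" if "x \<in> F" "dist x y < 1 / real (Suc n)" for x y
        using bound[OF that] ab by simp
    qed (use \<open>reflp le\<close> \<open>0 < s\<close> ab F(1) cont in auto)
    then have "ennreal (\<alpha> powr s) * emeasure H F
        \<le> ennreal (\<alpha> powr s) * (ennreal ((1 / \<alpha>) powr s) * emeasure N F)"
      by (rule mult_left_mono) simp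
    also have "\<dots> = emeasure N F"
      using ab by (simp flip: mult.assoc ennreal_mult powr_mult)
    finally have low: "ennreal (\<alpha> powr s) * emeasure H F \<le> emeasure N F" .
    have D: "emeasure ?D F = (\<integral>\<^sup>+x. ennreal (\<Omega> x powr s) * indicator F x \<partial>H)"
      using F(1) by (intro emeasure_density) (auto simp: sets_H)
    have const: "(\<integral>\<^sup>+x. ennreal k * indicator F x \<partial>H) = ennreal k * emeasure H F" for k
      using F(1) by (simp add: nn_integral_cmult_indicator sets_H)
    have D_low: "ennreal (\<alpha> powr s) * emeasure H F \<le> emeasure ?D F"
      unfolding D const[symmetric] using bound' ab \<open>0 < s\<close>
      by (intro nn_integral_mono) (auto simp: indicator_def intro!: ennreal_leI powr_mono2)
    have D_up: "emeasure ?D F \<le> ennreal (\<beta> powr s) * emeasure H F"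
      unfolding D const[symmetric] using bound' pos \<open>0 < s\<close>
      by (intro nn_integral_mono) (auto simp: indicator_def less_imp_le intro!: ennreal_leI powr_mono2)
    have "ennreal (\<beta> powr s) * emeasure H F
        \<le> ennreal (t powr s) * (ennreal (\<alpha> powr s) * emeasure H F)"
      using mult_right_mono[OF \<beta>\<alpha>, of "emeasure H F"] by (simp add: mult.assoc)
    then show ?thesis
      using up low D_low D_up by (meson mult_left_mono order_trans zero_le)
  qed simp
  show "emeasure N E \<le> ennreal (t powr s) * emeasure ?D E"
    by (rule emeasure_le_mult_if_locally[where A = A])
      (use A_borel A_cover E local in \<open>auto simp: sets_H sets_N\<close>)
  show "emeasure ?D E \<le> ennreal (t powr s) * emeasure N E"
    by (rule emeasure_le_mult_if_locally[where A = A])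
      (use A_borel A_cover E local in \<open>auto simp: sets_H sets_N\<close>)
qed

theorem theorem4p14:
  fixes ll le :: "'a::metric_space \<Rightarrow> 'a \<Rightarrow> bool"
    and \<tau> :: "'a \<Rightarrow> 'a \<Rightarrow> ennreal"
    and \<Omega> :: "'a \<Rightarrow> real"
    and s :: real
    and E :: "'a set"
  assumes "lorentzian_pre_length_space ll le \<tau>"
    and "intrinsic le \<tau>"
    and "separable_space (euclidean :: 'a topology)"
    and "s > 0"
    and "sigma_finite_measure (hausdorff_measure le \<tau> s)"
    and "continuous_on UNIV \<Omega>"
    and "\<forall>x. \<Omega> x > 0"
    and "E \<in> sets borel"
  shows "emeasure (hausdorff_measure le (conf_tau le \<tau> \<Omega>) s) E
           = (\<integral>\<^sup>+x\<in>E. ennreal (\<Omega> x powr s) \<partial>(hausdorff_measure le \<tau> s))"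
proof -
  have refl: "reflp le"
    by (rule lorentzian_pre_length_space.le_refl) fact
  have [measurable]: "\<Omega> \<in> borel_measurable borel"
    by (rule borel_measurable_continuous_onI[OF \<open>continuous_on UNIV \<Omega>\<close>])
  let ?H = "hausdorff_measure le \<tau> s" and ?N = "hausdorff_measure le (conf_tau le \<tau> \<Omega>) s"
  let ?D = "density ?H (\<lambda>x. \<Omega> x powr s)"
  note approx = hausdorff_conf_tau_approx[OF refl \<open>intrinsic le \<tau>\<close> \<open>s > 0\<close> \<open>continuous_on UNIV \<Omega>\<close>
      assms(7)[rule_format] _ \<open>E \<in> sets borel\<close>]
  \<comment> \<open>Every factor \<open>u > 1\<close> is \<open>t\<^sup>s\<close> for a ratio \<open>t > 1\<close>.\<close>
  have root: "1 < u powr (1 / s)" "(u powr (1 / s)) powr s = u" if "1 < u" for u :: real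
    using that \<open>s > 0\<close> by (simp_all add: powr_powr gr_one_powr)
  have "emeasure ?N E = emeasure ?D E"
  proof (rule antisym; rule ennreal_le_if_le_mult_gt_1)
    fix u :: real assume "1 < u"
    show "emeasure ?N E \<le> ennreal u * emeasure ?D E" "emeasure ?D E \<le> ennreal u * emeasure ?N E"
      using approx[OF root(1)[OF \<open>1 < u\<close>]] unfolding root(2)[OF \<open>1 < u\<close>] .
  qed
  also have "\<dots> = (\<integral>\<^sup>+x\<in>E. ennreal (\<Omega> x powr s) \<partial>?H)"
    using \<open>E \<in> sets borel\<close> by (intro emeasure_density) auto
  finally show ?thesis .
qed

end
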